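(* Let $\mu>0$, let $\tau\ge0$ be an integer, and let $F:\mathbb{R}^d\to\mathbb{R}$ be a $\mu$-smooth convex quadratic function that is bounded from below, with a minimizer $\mathbf{w}^*$. Let $\eta\in\left(0,\frac{1}{20\mu(\tau+1)}\right]$ and let $(\mathbf{w}_k)_{k\ge0}$ be the iterates of delayed gradient descent (DGD) on $F$ with delay $\tau$, step size $\eta$ and initial point $\mathbf{w}_0$. Then for every integer $k\ge(\tau+1)\ln(2(\tau+1))$, $$F(\mathbf{w}_k)-F(\mathbf{w}^* )\le\frac{9}{4e\,\eta\,(k+1)}\,\|\mathbf{w}_0-\mathbf{w}^*\|^2,$$ where $e=2.718\ldots$ is Euler's number. In particular, if $\tau\ge1$ and $\eta=\Omega(1/(\mu\tau))$ (with $\eta\in\left(0,\frac{1}{20\mu(\tau+1)}\right]$), then $$F(\mathbf{w}_k)-F(\mathbf{w}^* )\le\mathcal{O}\left(\frac{\mu\tau\|\mathbf{w}_0-\mathbf{w}^*\|^2}{k}\right);$$ that is, for every constant $c>0$ there is a constant $C>0$ depending only on $c$ such that, whenever $\eta\ge c/(\mu\tau)$, the left-hand side is at most $C\mu\tau\|\mathbf{w}_0-\mathbf{w}^*\|^2/k$.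
   Context: A quadratic function is $F(\mathbf{w})=\frac12\mathbf{w}^\top A\mathbf{w}+\mathbf{b}^\top\mathbf{w}+c_0$ with $A\in\mathbb{R}^{d\times d}$ symmetric, $\mathbf{b}\in\mathbb{R}^d$, $c_0\in\mathbb{R}$. It is convex and $\mu$-smooth when all eigenvalues of $A$ lie in $[0,\mu]$. Norms are Euclidean. Delayed gradient descent (DGD) with delay $\tau$ and step size $\eta$: given $\mathbf{w}_0\in\mathbb{R}^d$, set $\mathbf{w}_0=\mathbf{w}_1=\dots=\mathbf{w}_\tau$, and for $k\ge\tau$ set $\mathbf{w}_{k+1}=\mathbf{w}_k-\eta\nabla F(\mathbf{w}_{k-\tau})$. *)

theory Defs
  imports "HOL-Analysis.Derivative" "Jordan_Normal_Form.Char_Poly"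
begin

unbundle no inner_syntax

text \<open>
  Points of \<open>\<real>\<^sup>d\<close> are the elements of \<open>carrier_vec d :: real vec set\<close>, so that the dimension
  is an ordinary natural number and constants can be chosen independently of it.
  The behaviour of a function \<open>F :: real vec \<Rightarrow> real\<close> outside \<open>carrier_vec d\<close> is irrelevant.
\<close>

definition euclid_norm :: "real vec \<Rightarrow> real" where
  "euclid_norm v = sqrt (v \<bullet> v)"

definition quadratic :: "real mat \<Rightarrow> real vec \<Rightarrow> real \<Rightarrow> real vec \<Rightarrow> real" where
  "quadratic A b c\<^sub>0 w = 1 / 2 * (w \<bullet> (A *\<^sub>v w)) + b \<bullet> w + c\<^sub>0"

text \<open>Since \<open>A\<close> is symmetric, its eigenvalues are all real, so quantifying over the
  real eigenvalues covers the whole spectrum.\<close>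

definition smooth_convex_quadratic :: "nat \<Rightarrow> real \<Rightarrow> (real vec \<Rightarrow> real) \<Rightarrow> bool" where
  "smooth_convex_quadratic d \<mu> F \<longleftrightarrow>
     (\<exists>A b c\<^sub>0. A \<in> carrier_mat d d \<and> transpose_mat A = A \<and> b \<in> carrier_vec d \<and>
        (\<forall>l. eigenvalue A l \<longrightarrow> 0 \<le> l \<and> l \<le> \<mu>) \<and>
        (\<forall>w \<in> carrier_vec d. F w = quadratic A b c\<^sub>0 w))"

text \<open>The gradient as the vector of partial derivatives.\<close>

definition grad :: "(real vec \<Rightarrow> real) \<Rightarrow> real vec \<Rightarrow> real vec" where
  "grad F w = vec (dim_vec w)
     (\<lambda>i. deriv (\<lambda>t. F (w + t \<cdot>\<^sub>v unit_vec (dim_vec w) i)) 0)"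

fun dgd :: "(real vec \<Rightarrow> real) \<Rightarrow> nat \<Rightarrow> real \<Rightarrow> real vec \<Rightarrow> nat \<Rightarrow> real vec" where
  "dgd F \<tau> \<eta> w\<^sub>0 0 = w\<^sub>0"
| "dgd F \<tau> \<eta> w\<^sub>0 (Suc k) =
     (if k < \<tau> then w\<^sub>0
      else dgd F \<tau> \<eta> w\<^sub>0 k - \<eta> \<cdot>\<^sub>v grad F (dgd F \<tau> \<eta> w\<^sub>0 (k - \<tau>)))"

lemma grad_quadratic:
  assumes A: "A \<in> carrier_mat d d" and sym: "transpose_mat A = A"
    and b: "b \<in> carrier_vec d" and w: "w \<in> carrier_vec d"
    and F: "\<forall>w \<in> carrier_vec d. F w = quadratic A b c\<^sub>0 w"
  shows "grad F w = A *\<^sub>v w + b"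
proof (rule eq_vecI)
  have dw: "dim_vec w = d" using w by simp
  show "dim_vec (grad F w) = dim_vec (A *\<^sub>v w + b)"
    using b w by (simp add: grad_def)
  fix i assume "i < dim_vec (A *\<^sub>v w + b)"
  then have i: "i < d" using b by simp
  let ?e = "unit_vec d i :: real vec"
  have e: "?e \<in> carrier_vec d" by simp
  have Aw: "A *\<^sub>v w \<in> carrier_vec d" and Ae: "A *\<^sub>v ?e \<in> carrier_vec d"
    using A w by auto
  have swap: "w \<bullet> (A *\<^sub>v ?e) = ?e \<bullet> (A *\<^sub>v w)"
    using transpose_vec_mult_scalar[OF A e w] sym
    by (metis Aw comm_scalar_prod e)
  have ee: "?e \<bullet> (A *\<^sub>v w) = (A *\<^sub>v w) $ i"
    using Aw i by (rule scalar_prod_left_unit)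
  have be: "b \<bullet> ?e = b $ i"
    using i by (simp add: b)
  have F_line: "F (w + t \<cdot>\<^sub>v ?e) =
      quadratic A b c\<^sub>0 w + t * ((A *\<^sub>v w) $ i + b $ i) + t\<^sup>2 * (1 / 2 * (?e \<bullet> (A *\<^sub>v ?e)))" for t
  proof -
    have te: "t \<cdot>\<^sub>v ?e \<in> carrier_vec d" by simp
    have A_line: "A *\<^sub>v (w + t \<cdot>\<^sub>v ?e) = A *\<^sub>v w + t \<cdot>\<^sub>v (A *\<^sub>v ?e)"
      using A w e by (simp add: mult_add_distrib_mat_vec[OF A w te] mult_mat_vec[OF A e])
    have "(w + t \<cdot>\<^sub>v ?e) \<bullet> (A *\<^sub>v w + t \<cdot>\<^sub>v (A *\<^sub>v ?e)) =
        w \<bullet> (A *\<^sub>v w) + t * (w \<bullet> (A *\<^sub>v ?e)) +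
        (t * (?e \<bullet> (A *\<^sub>v w)) + t * (t * (?e \<bullet> (A *\<^sub>v ?e))))"
      using w e Aw Ae
      by (simp add: add_scalar_prod_distrib[of _ d] scalar_prod_add_distrib[of _ d]
          smult_scalar_prod_distrib[of _ d] scalar_prod_smult_distrib[of _ d] distrib_left
          del: scalar_prod_left_unit scalar_prod_right_unit)
    moreover have "b \<bullet> (w + t \<cdot>\<^sub>v ?e) = b \<bullet> w + t * b $ i"
      using b w e by (simp add: scalar_prod_add_distrib[of _ d] be del: scalar_prod_right_unit)
    moreover have "F (w + t \<cdot>\<^sub>v ?e) = quadratic A b c\<^sub>0 (w + t \<cdot>\<^sub>v ?e)"
      using F w by auto
    ultimately show ?thesis
      by (simp only: quadratic_def A_line swap ee) (simp add: algebra_simps power2_eq_square)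
  qed
  have "((\<lambda>t. F (w + t \<cdot>\<^sub>v ?e)) has_field_derivative ((A *\<^sub>v w) $ i + b $ i)) (at 0)"
    unfolding F_line by (auto intro!: derivative_eq_intros)
  then show "grad F w $ i = (A *\<^sub>v w + b) $ i"
    using i b Aw by (simp add: grad_def dw DERIV_imp_deriv)
qed

end

theory Submission
  imports Defs "Jordan_Normal_Form.Spectral_Radius"
begin

text \<open>
  In the coordinates of an orthonormal eigenbasis of \<open>A\<close>, the error \<open>w\<^sub>k - wstar\<close> splits into scalar
  recursions \<open>s (k + 1) = s k - x * s (k - \<tau>)\<close> with \<open>x = \<eta> * l\<close> for an eigenvalue \<open>l\<close>. Because
  \<open>x * (\<tau> + 1) \<le> 1 / 20\<close>, such a sequence started at \<open>c \<ge> 0\<close> retains at least the fraction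
  \<open>1 - 2 * x\<close> in each step, hence stays nonnegative and decreasing. Then \<open>s (k - \<tau>) \<ge> s k\<close>, so it decays
  at least like \<open>(1 - x) ^ k\<close>; the lag of \<open>\<tau> + 1\<close> steps costs only a factor \<open>20 / 19\<close>. Finally
  \<open>x * exp (- (2 * x * (k + 1))) \<le> 1 / (2 * e * (k + 1))\<close> uniformly in \<open>x\<close>, and Parseval sums up the
  coordinates.
\<close>

unbundle no vec_syntax

section \<open>Spectral theorem for real symmetric matrices\<close>

lemma symmetric_scalar_prod_swap:
  fixes A :: "'a::comm_semiring_0 mat"
  assumes "A \<in> carrier_mat n n" "transpose_mat A = A" "x \<in> carrier_vec n" "y \<in> carrier_vec n"
  shows "(A *\<^sub>v x) \<bullet> y = x \<bullet> (A *\<^sub>v y)"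
  using transpose_vec_mult_scalar[OF assms(1,4,3)] assms(2) by simp

lemma real_scalar_prod_self:
  fixes v :: "real vec"
  shows "0 \<le> v \<bullet> v" and "v \<in> carrier_vec n \<Longrightarrow> v \<bullet> v = 0 \<longleftrightarrow> v = 0\<^sub>v n"
  using conjugate_square_ge_0_vec[of v] conjugate_square_eq_0_vec[of v n] by auto

lemma symmetric_real_mat_eigenvector_exists:
  fixes A :: "real mat"
  assumes A: "A \<in> carrier_mat n n" and sym: "transpose_mat A = A" and n: "n > 0"
  shows "\<exists>v l. eigenvector A v l"
proof -
  \<comment> \<open>The real and imaginary parts of a complex eigenvector span an \<open>A\<close>-invariant space,
    on which symmetry forces the eigenvalue to be real.\<close>
  let ?A = "map_mat complex_of_real A"
  have cA: "?A \<in> carrier_mat n n" using A by simp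
  obtain z where "eigenvalue ?A z"
    using spectrum_non_empty[OF cA] n by (auto simp: spectrum_def)
  then obtain v where v: "v \<in> carrier_vec n" and v0: "v \<noteq> 0\<^sub>v n" and ev: "?A *\<^sub>v v = z \<cdot>\<^sub>v v"
    using cA by (auto simp: eigenvalue_def eigenvector_def)
  define u where "u = map_vec Re v"
  define w where "w = map_vec Im v"
  have u: "u \<in> carrier_vec n" and w: "w \<in> carrier_vec n" using v by (auto simp: u_def w_def)
  have comp: "row ?A i \<bullet> v = z * v $ i" if "i < n" for i
    using arg_cong[OF ev, of "\<lambda>x. x $ i"] that A v by simp
  have Au: "A *\<^sub>v u = Re z \<cdot>\<^sub>v u - Im z \<cdot>\<^sub>v w"
  proof (rule eq_vecI)
    fix i assume "i < dim_vec (Re z \<cdot>\<^sub>v u - Im z \<cdot>\<^sub>v w)"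
    then have i: "i < n" using w by simp
    have "row A i \<bullet> u = Re (row ?A i \<bullet> v)"
      using i A v by (simp add: scalar_prod_def u_def)
    then show "(A *\<^sub>v u) $ i = (Re z \<cdot>\<^sub>v u - Im z \<cdot>\<^sub>v w) $ i"
      using i A v comp[OF i] by (simp add: u_def w_def)
  qed (use A u w in auto)
  have Aw: "A *\<^sub>v w = Im z \<cdot>\<^sub>v u + Re z \<cdot>\<^sub>v w"
  proof (rule eq_vecI)
    fix i assume "i < dim_vec (Im z \<cdot>\<^sub>v u + Re z \<cdot>\<^sub>v w)"
    then have i: "i < n" using w by simp
    have "row A i \<bullet> w = Im (row ?A i \<bullet> v)"
      using i A v by (simp add: scalar_prod_def w_def)
    then show "(A *\<^sub>v w) $ i = (Im z \<cdot>\<^sub>v u + Re z \<cdot>\<^sub>v w) $ i"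
      using i A v comp[OF i] by (simp add: u_def w_def)
  qed (use A u w in auto)
  have nz: "u \<noteq> 0\<^sub>v n \<or> w \<noteq> 0\<^sub>v n"
  proof (rule ccontr)
    assume "\<not> ?thesis"
    then have 0: "u = 0\<^sub>v n" "w = 0\<^sub>v n" by auto
    have "v $ i = 0" if "i < n" for i
      using arg_cong[OF 0(1), of "\<lambda>x. x $ i"] arg_cong[OF 0(2), of "\<lambda>x. x $ i"] that v
      by (simp add: u_def w_def complex_eq_iff)
    then have "v = 0\<^sub>v n" using v by (intro eq_vecI) auto
    with v0 show False by simp
  qed
  then have pos: "u \<bullet> u + w \<bullet> w > 0"
    using real_scalar_prod_self[of u] real_scalar_prod_self[of w] u w
    by (metis add_nonneg_eq_0_iff add_nonneg_nonneg less_le)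
  \<comment> \<open>Expanding both sides, the terms \<open>Re z * (u \<bullet> w)\<close> cancel and
    only \<open>Im z\<close> times the sum of the squared lengths remains.\<close>
  have "(Re z \<cdot>\<^sub>v u - Im z \<cdot>\<^sub>v w) \<bullet> w = u \<bullet> (Im z \<cdot>\<^sub>v u + Re z \<cdot>\<^sub>v w)"
    using symmetric_scalar_prod_swap[OF A sym u w] by (simp only: Au Aw)
  then have "Im z * (u \<bullet> u + w \<bullet> w) = 0"
    using u w by (simp add: minus_scalar_prod_distrib[of _ n] scalar_prod_add_distrib[of _ n] algebra_simps)
  then have Im: "Im z = 0" using pos by simp
  \<comment> \<open>With \<open>Im z = 0\<close> both parts satisfy the real eigenvalue equation,
    and at least one of them is nonzero.\<close>
  have "A *\<^sub>v u = Re z \<cdot>\<^sub>v u" "A *\<^sub>v w = Re z \<cdot>\<^sub>v w"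
    unfolding Au Aw Im using u w by (auto intro!: eq_vecI)
  then show ?thesis using nz A u w unfolding eigenvector_def by auto
qed

text \<open>For \<open>u = 0\<close> the division by zero yields the identity matrix, so that the lemmas below
  need no case distinction.\<close>

definition householder :: "nat \<Rightarrow> real vec \<Rightarrow> real mat" where
  "householder n u = mat n n (\<lambda>(i, j). (if i = j then 1 else 0) - 2 / (u \<bullet> u) * u $ i * u $ j)"

lemma householder_carrier [simp]: "householder n u \<in> carrier_mat n n"
  by (simp add: householder_def)

lemma householder_symmetric [simp]: "transpose_mat (householder n u) = householder n u"
  by (rule eq_matI) (auto simp: householder_def)

lemma householder_involution:
  assumes u: "u \<in> carrier_vec n"
  shows "householder n u * householder n u = 1\<^sub>m n"
proof (rule eq_matI)
  fix i j assume "i < dim_row (1\<^sub>m n :: real mat)" "j < dim_col (1\<^sub>m n :: real mat)"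
  then have i: "i < n" and j: "j < n" by auto
  define c where "c = 2 / (u \<bullet> u)"
  have s: "(\<Sum>k = 0..<n. u $ k * u $ k) = u \<bullet> u" using u by (simp add: scalar_prod_def)
  \<comment> \<open>True also for \<open>u \<bullet> u = 0\<close>, where \<open>c = 0\<close>. This
    identity makes the two terms in \<open>u $ i * u $ j\<close> cancel below.\<close>
  have c: "c * (c * (u \<bullet> u)) = 2 * c" by (simp add: c_def)
  have "(householder n u * householder n u) $$ (i, j)
      = (\<Sum>k = 0..<n. ((if i = k then 1 else 0) - c * u $ i * u $ k) * ((if k = j then 1 else 0) - c * u $ k * u $ j))"
    using i j by (simp add: householder_def scalar_prod_def c_def)
  also have "\<dots> = (\<Sum>k = 0..<n. (if i = k then if k = j then 1 else 0 else 0)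
       - (if i = k then c * u $ i * u $ j else 0) - (if k = j then c * u $ i * u $ j else 0)
       + c * c * u $ i * u $ j * (u $ k * u $ k))"
    by (rule sum.cong) (auto simp: algebra_simps)
  also have "\<dots> = (if i = j then 1 else 0) - 2 * (c * u $ i * u $ j) + c * c * u $ i * u $ j * (u \<bullet> u)"
    using i j by (simp add: sum.distrib sum_subtractf s flip: sum_distrib_left)
  also have "c * c * u $ i * u $ j * (u \<bullet> u) = (c * (c * (u \<bullet> u))) * u $ i * u $ j" by simp
  also have "(if i = j then 1 else 0) - 2 * (c * u $ i * u $ j) + \<dots> = 1\<^sub>m n $$ (i, j)"
    unfolding c using i j by simp
  finally show "(householder n u * householder n u) $$ (i, j) = 1\<^sub>m n $$ (i, j)" .
qed (auto simp: householder_def)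

text \<open>Two vectors of equal length are exchanged by the reflection along their difference. This
  provides an orthogonal symmetric matrix whose first column is a prescribed unit vector.\<close>

lemma householder_first_col:
  assumes v: "v \<in> carrier_vec n" and unit: "v \<bullet> v = 1" and n: "n > 0"
  shows "householder n (v - unit_vec n 0) *\<^sub>v unit_vec n 0 = v"
proof (rule eq_vecI)
  define u where "u = v - unit_vec n 0"
  have u: "u \<in> carrier_vec n" using v by (simp add: u_def)
  have u0: "u $ 0 = v $ 0 - 1" using n v by (simp add: u_def)
  have uu: "u \<bullet> u = 2 - 2 * v $ 0"
    using n v unit unfolding u_def
    by (simp add: minus_scalar_prod_distrib[of _ n] scalar_prod_minus_distrib[of _ n])
  fix i assume "i < dim_vec v"
  then have i: "i < n" using v by simp
  have "(householder n u *\<^sub>v unit_vec n 0) $ i = (if i = 0 then 1 else 0) - 2 / (u \<bullet> u) * u $ i * u $ 0"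
    using i n by (simp add: householder_def)
  also have "\<dots> = (if i = 0 then 1 else 0) + u $ i"
  proof (cases "u \<bullet> u = 0")
    case True
    then have "u = 0\<^sub>v n" using real_scalar_prod_self(2)[OF u] by simp
    then show ?thesis using i by simp
  next
    case False
    \<comment> \<open>Here \<open>u \<bullet> u = -2 * u $ 0\<close>, so the reflection subtracts
      exactly \<open>- u\<close> from the basis vector.\<close>
    then have "1 - v $ 0 \<noteq> 0" using uu by simp
    then have "2 / (u \<bullet> u) * u $ 0 = - 1" unfolding uu u0 by (simp add: divide_simps)
    then have "2 / (u \<bullet> u) * u $ 0 * u $ i = - u $ i" by simp
    then show ?thesis by (simp add: mult.commute mult.left_commute)
  qed
  also have "\<dots> = v $ i" using i v n by (simp add: u_def)
  finally show "(householder n (v - unit_vec n 0) *\<^sub>v unit_vec n 0) $ i = v $ i" by (simp add: u_def)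
qed (use v in \<open>simp add: householder_def\<close>)

text \<open>Deflation: a reflection \<open>H\<close> carrying the first basis vector to a unit
  eigenvector makes that basis vector an eigenvector of \<open>H * A * H\<close>. The first column
  is then \<open>l\<close> followed by zeros, and symmetry clears the first row as well.\<close>

lemma symmetric_real_mat_block_reduction:
  fixes A :: "real mat"
  assumes A: "A \<in> carrier_mat (Suc n) (Suc n)" and sym: "transpose_mat A = A"
  shows "\<exists>H l B. H \<in> carrier_mat (Suc n) (Suc n) \<and> transpose_mat H = H \<and> H * H = 1\<^sub>m (Suc n) \<and>
    B \<in> carrier_mat n n \<and> transpose_mat B = B \<and>
    H * A * H = four_block_mat (mat 1 1 (\<lambda>_. l)) (0\<^sub>m 1 n) (0\<^sub>m n 1) B"
proof -
  let ?N = "Suc n"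
  let ?e = "unit_vec ?N 0 :: real vec"
  obtain v' l where "eigenvector A v' l"
    using symmetric_real_mat_eigenvector_exists[OF A sym] by auto
  then have v': "v' \<in> carrier_vec ?N" "v' \<noteq> 0\<^sub>v ?N" "A *\<^sub>v v' = l \<cdot>\<^sub>v v'"
    using A by (auto simp: eigenvector_def)
  have pos: "v' \<bullet> v' > 0"
    using real_scalar_prod_self[of v'] v'(1,2) by (metis less_le)
  define v where "v = (1 / sqrt (v' \<bullet> v')) \<cdot>\<^sub>v v'"
  have v: "v \<in> carrier_vec ?N" using v' by (simp add: v_def)
  have unit: "v \<bullet> v = 1"
    using pos v'(1) by (simp add: v_def divide_simps)
  have Av: "A *\<^sub>v v = l \<cdot>\<^sub>v v"
    unfolding v_def using v' A by (simp add: mult_mat_vec[OF A v'(1)] smult_smult_assoc mult.commute)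
  define H where "H = householder ?N (v - ?e)"
  have H: "H \<in> carrier_mat ?N ?N" and Hsym: "transpose_mat H = H" by (auto simp: H_def)
  have HH: "H * H = 1\<^sub>m ?N" unfolding H_def by (rule householder_involution) (use v in simp)
  have He: "H *\<^sub>v ?e = v" unfolding H_def using v unit by (rule householder_first_col) simp
  have Hv: "H *\<^sub>v v = ?e"
  proof -
    have "H *\<^sub>v v = (H * H) *\<^sub>v ?e" using H by (simp add: He[symmetric])
    then show ?thesis by (simp add: HH)
  qed
  define A' where "A' = H * A * H"
  have A': "A' \<in> carrier_mat ?N ?N" using A H by (auto simp: A'_def)
  have A'sym: "transpose_mat A' = A'"
    using A H sym Hsym by (simp add: A'_def transpose_mult[of _ ?N ?N _ ?N])
  have A'e: "A' *\<^sub>v ?e = l \<cdot>\<^sub>v ?e"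
  proof -
    have "A' *\<^sub>v ?e = H *\<^sub>v (A *\<^sub>v (H *\<^sub>v ?e))"
      using A H by (simp add: A'_def assoc_mult_mat_vec[of _ ?N ?N _ ?N])
    also have "\<dots> = l \<cdot>\<^sub>v ?e" unfolding He Av by (simp add: mult_mat_vec[OF H v] Hv)
    finally show ?thesis .
  qed
  have col0: "A' $$ (i, 0) = (if i = 0 then l else 0)" if "i < ?N" for i
    using arg_cong[OF A'e, of "\<lambda>x. x $ i"] that A' by simp
  have symm: "A' $$ (i, j) = A' $$ (j, i)" if "i < ?N" "j < ?N" for i j
    using arg_cong[OF A'sym, of "\<lambda>M. M $$ (i, j)"] that A' by simp
  define B where "B = mat n n (\<lambda>(i, j). A' $$ (Suc i, Suc j))"
  have "B \<in> carrier_mat n n" by (simp add: B_def)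
  moreover have "transpose_mat B = B" by (rule eq_matI) (auto simp: B_def symm)
  moreover have "A' = four_block_mat (mat 1 1 (\<lambda>_. l)) (0\<^sub>m 1 n) (0\<^sub>m n 1) B"
  proof (rule eq_matI)
    fix i j
    assume "i < dim_row (four_block_mat (mat 1 1 (\<lambda>_. l)) (0\<^sub>m 1 n) (0\<^sub>m n 1) B)"
      "j < dim_col (four_block_mat (mat 1 1 (\<lambda>_. l)) (0\<^sub>m 1 n) (0\<^sub>m n 1) B)"
    then have "i < ?N" "j < ?N" by (auto simp: B_def)
    then show "A' $$ (i, j) = four_block_mat (mat 1 1 (\<lambda>_. l)) (0\<^sub>m 1 n) (0\<^sub>m n 1) B $$ (i, j)"
      using col0[of i] col0[of j] symm[of 0 j] by (cases i; cases j) (auto simp: B_def)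
  qed (use A' in \<open>auto simp: B_def\<close>)
  ultimately show ?thesis using H Hsym HH unfolding A'_def by blast
qed

text \<open>Induction on the dimension: the diagonalizing matrix \<open>U\<close> of the smaller
  block is bordered by a 1 to give \<open>Q\<close>, and \<open>H * Q\<close> undoes the deflation.
  It is orthogonal because both factors are.\<close>

theorem symmetric_real_mat_diagonalization:
  fixes A :: "real mat"
  assumes "A \<in> carrier_mat n n" and "transpose_mat A = A"
  shows "\<exists>P D. P \<in> carrier_mat n n \<and> D \<in> carrier_mat n n \<and> transpose_mat P * P = 1\<^sub>m n \<and>
    diagonal_mat D \<and> A * P = P * D"
  using assms
proof (induction n arbitrary: A)
  case 0
  then show ?case
    by (intro exI[of _ "1\<^sub>m 0"] exI[of _ A]) (auto simp: diagonal_mat_def)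
next
  case (Suc n)
  let ?N = "Suc n"
  have A: "A \<in> carrier_mat ?N ?N" by fact
  obtain H l B where H: "H \<in> carrier_mat ?N ?N" and Hsym: "transpose_mat H = H"
    and HH: "H * H = 1\<^sub>m ?N" and B: "B \<in> carrier_mat n n" and Bsym: "transpose_mat B = B"
    and HAH: "H * A * H = four_block_mat (mat 1 1 (\<lambda>_. l)) (0\<^sub>m 1 n) (0\<^sub>m n 1) B"
    using symmetric_real_mat_block_reduction[OF Suc.prems] by blast
  obtain U E where U: "U \<in> carrier_mat n n" and E: "E \<in> carrier_mat n n"
    and UU: "transpose_mat U * U = 1\<^sub>m n" and Ediag: "diagonal_mat E" and BU: "B * U = U * E"
    using Suc.IH[OF B Bsym] by blast
  define L where "L = mat 1 1 (\<lambda>_. l)"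
  have L: "L \<in> carrier_mat 1 1" by (simp add: L_def)
  define Q where "Q = four_block_mat (1\<^sub>m 1) (0\<^sub>m 1 n) (0\<^sub>m n 1) U"
  define D where "D = four_block_mat L (0\<^sub>m 1 n) (0\<^sub>m n 1) E"
  have Q: "Q \<in> carrier_mat ?N ?N" and D: "D \<in> carrier_mat ?N ?N"
    using U E L four_block_carrier_mat[of _ 1 1 _ n n] by (auto simp: Q_def D_def)
  have QT: "transpose_mat Q = four_block_mat (1\<^sub>m 1) (0\<^sub>m 1 n) (0\<^sub>m n 1) (transpose_mat U)"
    unfolding Q_def using U by (subst transpose_four_block_mat[of _ 1 1 _ n _ n]) auto
  have "transpose_mat Q * Q = four_block_mat (1\<^sub>m 1) (0\<^sub>m 1 n) (0\<^sub>m n 1) (transpose_mat U * U)"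
    unfolding QT unfolding Q_def using U
    by (subst mult_four_block_mat[of _ 1 1 _ n _ n _ _ 1 _ n]) auto
  then have QQ: "transpose_mat Q * Q = 1\<^sub>m ?N" by (simp add: UU)
  have "(H * A * H) * Q = four_block_mat L (0\<^sub>m 1 n) (0\<^sub>m n 1) (B * U)"
    unfolding HAH L_def[symmetric] Q_def using U B L
    by (subst mult_four_block_mat[of _ 1 1 _ n _ n _ _ 1 _ n]) auto
  moreover have "Q * D = four_block_mat L (0\<^sub>m 1 n) (0\<^sub>m n 1) (U * E)"
    unfolding Q_def D_def using U E L
    by (subst mult_four_block_mat[of _ 1 1 _ n _ n _ _ 1 _ n]) auto
  ultimately have HAHQ: "(H * A * H) * Q = Q * D" by (simp add: BU)
  define P where "P = H * Q"
  have P: "P \<in> carrier_mat ?N ?N" using H Q by (simp add: P_def)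
  have "transpose_mat P * P = transpose_mat Q * ((H * H) * Q)"
    using H Q Hsym by (simp add: P_def transpose_mult[of _ ?N ?N] assoc_mult_mat[of _ ?N ?N _ ?N _ ?N])
  then have PP: "transpose_mat P * P = 1\<^sub>m ?N" using Q by (simp add: HH QQ)
  have "P * D = H * ((H * A * H) * Q)"
    using H Q D by (simp add: P_def HAHQ)
  also have "\<dots> = (H * H) * (A * (H * Q))"
    using H Q A by (simp add: assoc_mult_mat[of _ ?N ?N _ ?N _ ?N])
  also have "\<dots> = A * P" using A P by (simp add: HH P_def)
  finally have AP: "A * P = P * D" ..
  have "diagonal_mat D"
    using Ediag E L by (auto simp: D_def diagonal_mat_def)
  with P D PP AP show ?case by blast
qed

text \<open>With \<open>Q\<close> the transpose of the diagonalizing matrix,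
  \<open>Q *\<^sub>v x\<close> lists the coordinates of \<open>x\<close> in an orthonormal
  eigenbasis. Knowing that each \<open>l i\<close> is an eigenvalue lets a bound on the spectrum be
  applied to it.\<close>

corollary symmetric_real_mat_eigencoordinates:
  fixes A :: "real mat"
  assumes A: "A \<in> carrier_mat n n" and sym: "transpose_mat A = A"
  shows "\<exists>Q l. Q \<in> carrier_mat n n \<and> transpose_mat Q * Q = 1\<^sub>m n \<and> (\<forall>i<n. eigenvalue A (l i)) \<and>
    (\<forall>x\<in>carrier_vec n. \<forall>i<n. (Q *\<^sub>v (A *\<^sub>v x)) $ i = l i * (Q *\<^sub>v x) $ i)"
proof -
  obtain P D where P: "P \<in> carrier_mat n n" and D: "D \<in> carrier_mat n n"
    and PP: "transpose_mat P * P = 1\<^sub>m n" and diag: "diagonal_mat D" and AP: "A * P = P * D"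
    using symmetric_real_mat_diagonalization[OF assms] by blast
  let ?Q = "transpose_mat P"
  have Q: "?Q \<in> carrier_mat n n" using P by simp
  have "P * ?Q = 1\<^sub>m n" using mat_mult_left_right_inverse[OF Q P PP] .
  then have "transpose_mat ?Q * ?Q = 1\<^sub>m n" by simp
  moreover have "eigenvalue A (D $$ (i, i))" if i: "i < n" for i
  proof -
    let ?e = "unit_vec n i :: real vec"
    have De: "D *\<^sub>v ?e = D $$ (i, i) \<cdot>\<^sub>v ?e"
      using D diag i by (intro eq_vecI) (auto simp: diagonal_mat_def)
    have "A *\<^sub>v (P *\<^sub>v ?e) = (A * P) *\<^sub>v ?e" using A P by simp
    also have "\<dots> = P *\<^sub>v (D *\<^sub>v ?e)" unfolding AP using P D by simp
    also have "\<dots> = D $$ (i, i) \<cdot>\<^sub>v (P *\<^sub>v ?e)" unfolding De by (rule mult_mat_vec[OF P]) simp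
    finally have "A *\<^sub>v (P *\<^sub>v ?e) = D $$ (i, i) \<cdot>\<^sub>v (P *\<^sub>v ?e)" .
    \<comment> \<open>A column of \<open>P\<close> cannot vanish, since multiplying it by the
      transpose of \<open>P\<close> recovers the basis vector.\<close>
    moreover have "P *\<^sub>v ?e \<noteq> 0\<^sub>v n"
    proof
      assume "P *\<^sub>v ?e = 0\<^sub>v n"
      moreover have "?Q *\<^sub>v 0\<^sub>v n = 0\<^sub>v n" using P by (intro eq_vecI) auto
      ultimately have "(?Q * P) *\<^sub>v ?e = 0\<^sub>v n" using P Q by simp
      then show False using i unfolding PP by simp
    qed
    ultimately show ?thesis using A P unfolding eigenvalue_def eigenvector_def by (auto intro!: exI[of _ "P *\<^sub>v ?e"])
  qed
  moreover have "(?Q *\<^sub>v (A *\<^sub>v x)) $ i = D $$ (i, i) * (?Q *\<^sub>v x) $ i"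
    if x: "x \<in> carrier_vec n" and i: "i < n" for x i
  proof -
    have DT: "transpose_mat D = D" using D diag by (intro eq_matI) (auto simp: diagonal_mat_def, metis)
    \<comment> \<open>Transposing \<open>A * P = P * D\<close> moves the diagonalization to the
      other side, as both \<open>A\<close> and \<open>D\<close> are symmetric.\<close>
    have "?Q * A = transpose_mat (A * P)" using A P sym by (simp add: transpose_mult[OF A P])
    also have "\<dots> = D * ?Q" using P D DT by (simp add: AP transpose_mult[OF P D])
    finally have "?Q *\<^sub>v (A *\<^sub>v x) = D *\<^sub>v (?Q *\<^sub>v x)"
      using A P D x by (metis Q assoc_mult_mat_vec)
    moreover have "(D *\<^sub>v y) $ i = D $$ (i, i) * y $ i" if y: "y \<in> carrier_vec n" for y
    proof -
      have "(D *\<^sub>v y) $ i = (\<Sum>j = 0..<n. D $$ (i, j) * y $ j)"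
        using D y i by (simp add: scalar_prod_def)
      also have "\<dots> = (\<Sum>j = 0..<n. if i = j then D $$ (i, i) * y $ i else 0)"
        using D i diag by (intro sum.cong) (auto simp: diagonal_mat_def)
      finally show ?thesis using i by simp
    qed
    ultimately show ?thesis using P x by simp
  qed
  ultimately show ?thesis using Q by (intro exI[of _ ?Q] exI[of _ "\<lambda>i. D $$ (i, i)"]) blast
qed

section \<open>Scalar recursions with delay\<close>

text \<open>The three claims are carried together by strong induction. The ratio bound over the last
  \<tau> steps gives \<open>s (k - \<tau>) \<le> 2 * s k\<close>, so the subtracted term is at most
  \<open>2 * x * s k\<close>, which is the ratio bound for the next step.\<close>

lemma delayed_recursion_monotone:
  fixes s :: "nat \<Rightarrow> real"
  assumes init: "\<And>k. k \<le> \<tau> \<Longrightarrow> s k = c"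
    and step: "\<And>k. k \<ge> \<tau> \<Longrightarrow> s (Suc k) = s k - x * s (k - \<tau>)"
    and c: "c \<ge> 0" and x: "0 \<le> x" "x * (real \<tau> + 1) \<le> 1 / 20"
  shows "0 \<le> s k \<and> s (Suc k) \<le> s k \<and> (1 - 2 * x) * s k \<le> s (Suc k)"
proof (induction k rule: less_induct)
  case (less k)
  have x20: "x \<le> 1 / 20" using x mult_left_mono[of 1 "real \<tau> + 1" x] by simp
  show ?case
  proof (cases "k < \<tau>")
    case True
    then have "s k = c" "s (Suc k) = c" using init by auto
    then show ?thesis using c x by (auto simp: algebra_simps)
  next
    case False
    have ratio: "(1 - 2 * x) ^ j * s (k - \<tau>) \<le> s (k - \<tau> + j)" if "k - \<tau> + j \<le> k" for j
      using that
    proof (induction j)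
      case (Suc j)
      have "(1 - 2 * x) ^ Suc j * s (k - \<tau>) \<le> (1 - 2 * x) * s (k - \<tau> + j)"
        using Suc x20 by (simp add: mult.assoc mult_left_mono)
      also have "\<dots> \<le> s (k - \<tau> + Suc j)" using less[of "k - \<tau> + j"] Suc.prems by simp
      finally show ?case .
    qed simp
    \<comment> \<open>For \<open>\<tau> = 0\<close> the index \<open>k - \<tau>\<close> is
      \<open>k\<close> itself, outside the induction hypothesis. Nonnegativity is therefore drawn
      from the ratio bound at the predecessor.\<close>
    have "0 \<le> s j" if "j \<le> k" for j
    proof (cases j)
      case 0
      then show ?thesis using init[of 0] c by simp
    next
      case (Suc i)
      then have "0 \<le> (1 - 2 * x) * s i" "(1 - 2 * x) * s i \<le> s j" using less[of i] that x20 by auto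
      then show ?thesis by linarith
    qed
    then have nonneg: "0 \<le> s (k - \<tau>)" by simp
    \<comment> \<open>Bernoulli with \<open>2 * x * \<tau> \<le> 1 / 10\<close> gives far more than
      the 1/2 that the factor 2 in the ratio requires.\<close>
    have "1 - real \<tau> * (2 * x) \<le> (1 - 2 * x) ^ \<tau>"
      using Bernoulli_inequality[of "- (2 * x)" \<tau>] x20 by simp
    then have "1 / 2 \<le> (1 - 2 * x) ^ \<tau>" using x by (simp add: algebra_simps)
    then have "1 / 2 * s (k - \<tau>) \<le> (1 - 2 * x) ^ \<tau> * s (k - \<tau>)"
      using nonneg by (rule mult_right_mono)
    also have "\<dots> \<le> s k" using ratio[of \<tau>] False by simp
    finally have half: "s (k - \<tau>) \<le> 2 * s k" by simp
    have "x * s (k - \<tau>) \<le> x * (2 * s k)" using half x by (intro mult_left_mono) auto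
    moreover have "0 \<le> x * s (k - \<tau>)" using nonneg x by simp
    ultimately show ?thesis using half nonneg step[of k] False by (simp add: algebra_simps)
  qed
qed

text \<open>Since \<open>s\<close> decreases, the delayed term is at least the current one, so each
  step from \<tau> on contracts by \<open>1 - x\<close>. This yields the exponent
  \<open>k - \<tau>\<close>; raising it to \<open>k + 1\<close> costs \<tau> + 1 factors, whose
  product is at least 19/20.\<close>

lemma delayed_recursion_geometric:
  fixes s :: "nat \<Rightarrow> real"
  assumes init: "\<And>k. k \<le> \<tau> \<Longrightarrow> s k = c"
    and step: "\<And>k. k \<ge> \<tau> \<Longrightarrow> s (Suc k) = s k - x * s (k - \<tau>)"
    and c: "c \<ge> 0" and x: "0 \<le> x" "x * (real \<tau> + 1) \<le> 1 / 20"
  shows "19 / 20 * s k \<le> (1 - x) ^ Suc k * c"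
proof -
  note mono = delayed_recursion_monotone[OF init step c x]
  have dec: "s (Suc i) \<le> s i" for i using mono by blast
  have x20: "x \<le> 1 / 20" using x mult_left_mono[of 1 "real \<tau> + 1" x] by simp
  have bern: "19 / 20 \<le> (1 - x) ^ Suc j" if "j \<le> \<tau>" for j
  proof -
    have "x * (real j + 1) \<le> x * (real \<tau> + 1)" using that x by (intro mult_left_mono) auto
    then show ?thesis using Bernoulli_inequality[of "- x" "Suc j"] x x20 by (simp add: algebra_simps)
  qed
  show ?thesis
  proof (cases "k < \<tau>")
    case True
    then show ?thesis using bern[of k] init[of k] c mult_right_mono[of "19/20" _ c] by simp
  next
    case False
    have "s (\<tau> + j) \<le> (1 - x) ^ j * c" for j
    proof (induction j)
      case 0 show ?case using init[of \<tau>] by simp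
    next
      case (Suc j)
      have "s (\<tau> + j) \<le> s j" by (rule lift_Suc_antimono_le[of s, OF dec]) simp
      then have "x * s (\<tau> + j) \<le> x * s j" using x by (intro mult_left_mono) auto
      then have "s (\<tau> + Suc j) \<le> (1 - x) * s (\<tau> + j)" using step[of "\<tau> + j"] by (simp add: algebra_simps)
      also have "\<dots> \<le> (1 - x) * ((1 - x) ^ j * c)" using Suc x20 by (intro mult_left_mono) auto
      finally show ?case by simp
    qed
    from this[of "k - \<tau>"] have "s k \<le> (1 - x) ^ (k - \<tau>) * c" using False by simp
    moreover have "0 \<le> s k" using mono by blast
    \<comment> \<open>The constant 19/20 is exchanged for the \<tau> + 1 missing factors.\<close>
    ultimately have "19 / 20 * s k \<le> (1 - x) ^ Suc \<tau> * ((1 - x) ^ (k - \<tau>) * c)"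
      using bern[of \<tau>] by (intro mult_mono) auto
    also have "\<dots> = (1 - x) ^ (Suc \<tau> + (k - \<tau>)) * c" by (simp only: power_add mult.assoc)
    finally show ?thesis using False by simp
  qed
qed

text \<open>The maximum is attained at \<open>y = 1\<close>, where the tangent bound
  \<open>1 + t \<le> exp t\<close> with \<open>t = y - 1\<close> is sharp.\<close>

lemma mult_exp_uminus_le: "(y::real) * exp (- y) \<le> 1 / exp 1"
proof -
  have "y \<le> exp (y - 1)" using exp_ge_add_one_self[of "y - 1"] by simp
  then show ?thesis by (simp add: exp_minus exp_diff field_simps)
qed

text \<open>The recursion is linear, so negating \<open>s\<close> reduces to
  \<open>c \<ge> 0\<close>. The geometric decay is then compared with an exponential, and the
  prefactor \<open>x\<close> is absorbed uniformly by maximizing \<open>y * exp (- y)\<close> at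
  \<open>y = 2 * x * (k + 1)\<close>.\<close>

lemma delayed_recursion_square_bound:
  fixes s :: "nat \<Rightarrow> real"
  assumes init: "\<And>k. k \<le> \<tau> \<Longrightarrow> s k = c"
    and step: "\<And>k. k \<ge> \<tau> \<Longrightarrow> s (Suc k) = s k - x * s (k - \<tau>)"
    and x: "0 \<le> x" "x * (real \<tau> + 1) \<le> 1 / 20"
  shows "x * (s k)\<^sup>2 \<le> 9 / (2 * exp 1 * (real k + 1)) * c\<^sup>2"
proof -
  have x20: "x \<le> 1 / 20" using x mult_left_mono[of 1 "real \<tau> + 1" x] by simp
  have abs: "19 / 20 * \<bar>s k\<bar> \<le> (1 - x) ^ Suc k * \<bar>c\<bar>"
  proof (cases "c \<ge> 0")
    case True
    then show ?thesis
      using delayed_recursion_geometric[OF init step True x, of \<tau>]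
        delayed_recursion_geometric[OF init step True x, of k]
        delayed_recursion_monotone[OF init step True x, of k] by simp
  next
    case False
    have "19 / 20 * - s k \<le> (1 - x) ^ Suc k * - c" "0 \<le> - s k"
      using delayed_recursion_geometric[of \<tau> "\<lambda>k. - s k" "- c" x k]
        delayed_recursion_monotone[of \<tau> "\<lambda>k. - s k" "- c" x k] init step x False by auto
    then show ?thesis using False by simp
  qed
  let ?m = "real k + 1"
  \<comment> \<open>The factor 20/19 is rounded up to 3, whose square is the 9 of the target
    constant.\<close>
  have "\<bar>s k\<bar> \<le> 3 * ((1 - x) ^ Suc k * \<bar>c\<bar>)" using abs abs_ge_zero[of "s k"] by linarith
  also have "\<dots> \<le> 3 * (exp (- x) ^ Suc k * \<bar>c\<bar>)"
    using exp_ge_add_one_self[of "- x"] x20 by (intro mult_left_mono mult_right_mono power_mono) auto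
  finally have "\<bar>s k\<bar>\<^sup>2 \<le> (3 * (exp (- x) ^ Suc k * \<bar>c\<bar>))\<^sup>2"
    by (rule power_mono) simp
  also have "\<dots> = 9 * exp (- (2 * x * ?m)) * c\<^sup>2"
    by (simp add: power_mult_distrib algebra_simps power2_eq_square flip: exp_of_nat_mult exp_add)
  finally have "x * (s k)\<^sup>2 \<le> x * (9 * exp (- (2 * x * ?m)) * c\<^sup>2)"
    using x by (simp add: mult_left_mono)
  also have "\<dots> = 9 / (2 * ?m) * (2 * x * ?m * exp (- (2 * x * ?m))) * c\<^sup>2"
    by (simp add: field_simps)
  also have "\<dots> \<le> 9 / (2 * ?m) * (1 / exp 1) * c\<^sup>2"
    by (intro mult_right_mono mult_left_mono mult_exp_uminus_le) auto
  also have "\<dots> = 9 / (2 * exp 1 * ?m) * c\<^sup>2" by (simp add: field_simps)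
  finally show ?thesis .
qed

section \<open>Quadratic functions and their minimizers\<close>

text \<open>Exact second-order Taylor expansion: symmetry merges the two mixed terms into the
  gradient term. At a stationary point only the quadratic form in \<open>h\<close> is left, which
  turns suboptimality into \<open>h \<bullet> (A *\<^sub>v h)\<close>.\<close>

lemma quadratic_add:
  assumes A: "A \<in> carrier_mat d d" and sym: "transpose_mat A = A" and b: "b \<in> carrier_vec d"
    and w: "w \<in> carrier_vec d" and h: "h \<in> carrier_vec d"
  shows "quadratic A b c\<^sub>0 (w + h) = quadratic A b c\<^sub>0 w + (A *\<^sub>v w + b) \<bullet> h + 1 / 2 * (h \<bullet> (A *\<^sub>v h))"
proof -
  have Aw: "A *\<^sub>v w \<in> carrier_vec d" and Ah: "A *\<^sub>v h \<in> carrier_vec d" using A w h by auto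
  have "w \<bullet> (A *\<^sub>v h) = (A *\<^sub>v w) \<bullet> h" "h \<bullet> (A *\<^sub>v w) = (A *\<^sub>v w) \<bullet> h"
    using symmetric_scalar_prod_swap[OF A sym w h] comm_scalar_prod[OF h Aw] by auto
  then show ?thesis
    using w h b Aw Ah
    by (simp add: quadratic_def mult_add_distrib_mat_vec[OF A] add_scalar_prod_distrib[of _ d]
        scalar_prod_add_distrib[of _ d] algebra_simps)
qed

text \<open>Along the line through \<open>w\<close> in the direction of its gradient
  \<open>g\<close>, the increment of the function is nonnegative and vanishes at 0, so its
  derivative there, \<open>g \<bullet> g\<close>, must be zero.\<close>

lemma quadratic_minimizer_stationary:
  assumes A: "A \<in> carrier_mat d d" and sym: "transpose_mat A = A" and b: "b \<in> carrier_vec d"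
    and w: "w \<in> carrier_vec d"
    and min: "\<And>x. x \<in> carrier_vec d \<Longrightarrow> quadratic A b c\<^sub>0 w \<le> quadratic A b c\<^sub>0 x"
  shows "A *\<^sub>v w + b = 0\<^sub>v d"
proof -
  define g where "g = A *\<^sub>v w + b"
  have g: "g \<in> carrier_vec d" using A b w by (simp add: g_def)
  let ?f = "\<lambda>t. t * (g \<bullet> g) + t\<^sup>2 * (1 / 2 * (g \<bullet> (A *\<^sub>v g)))"
  have "0 \<le> ?f t" for t
  proof -
    have "(t \<cdot>\<^sub>v g) \<bullet> (A *\<^sub>v (t \<cdot>\<^sub>v g)) = t\<^sup>2 * (g \<bullet> (A *\<^sub>v g))"
      using A g by (simp add: mult_mat_vec[OF A g] power2_eq_square)
    then show ?thesis
      using min[of "w + t \<cdot>\<^sub>v g"] quadratic_add[OF A sym b w, of "t \<cdot>\<^sub>v g" c\<^sub>0] g w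
      by (simp add: g_def[symmetric])
  qed
  moreover have "(?f has_real_derivative g \<bullet> g) (at 0)"
    by (auto intro!: derivative_eq_intros)
  ultimately have "g \<bullet> g = 0" by (intro DERIV_local_min[of ?f _ 0 1]) auto
  then show ?thesis using real_scalar_prod_self(2)[OF g] by (simp add: g_def)
qed

section \<open>Error dynamics of delayed gradient descent\<close>

lemma dgd_init: "k \<le> \<tau> \<Longrightarrow> dgd F \<tau> \<eta> w\<^sub>0 k = w\<^sub>0"
  by (cases k) auto

lemma grad_carrier: "w \<in> carrier_vec d \<Longrightarrow> grad F w \<in> carrier_vec d"
  by (simp add: grad_def)

lemma dgd_carrier:
  assumes "w\<^sub>0 \<in> carrier_vec d"
  shows "dgd F \<tau> \<eta> w\<^sub>0 k \<in> carrier_vec d"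
proof (induction k rule: less_induct)
  case (less k)
  show ?case
  proof (cases "k \<le> \<tau>")
    case True
    then show ?thesis using assms by (simp add: dgd_init)
  next
    case False
    then obtain j where j: "k = Suc j" "\<not> j < \<tau>" by (cases k) auto
    have "dgd F \<tau> \<eta> w\<^sub>0 j \<in> carrier_vec d" "grad F (dgd F \<tau> \<eta> w\<^sub>0 (j - \<tau>)) \<in> carrier_vec d"
      using j by (auto intro!: less grad_carrier)
    then show ?thesis using j by simp
  qed
qed

text \<open>Subtracting the stationarity equation from the gradient \<open>A *\<^sub>v w + b\<close>
  removes \<open>b\<close>, so the error obeys a homogeneous linear recursion.\<close>

lemma dgd_quadratic_error_step:
  assumes A: "A \<in> carrier_mat d d" and sym: "transpose_mat A = A" and b: "b \<in> carrier_vec d"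
    and F: "\<forall>w \<in> carrier_vec d. F w = quadratic A b c\<^sub>0 w"
    and w0: "w\<^sub>0 \<in> carrier_vec d" and ws: "wstar \<in> carrier_vec d"
    and stat: "A *\<^sub>v wstar + b = 0\<^sub>v d" and k: "k \<ge> \<tau>"
  shows "dgd F \<tau> \<eta> w\<^sub>0 (Suc k) - wstar
    = (dgd F \<tau> \<eta> w\<^sub>0 k - wstar) - \<eta> \<cdot>\<^sub>v (A *\<^sub>v (dgd F \<tau> \<eta> w\<^sub>0 (k - \<tau>) - wstar))"
proof -
  let ?w = "dgd F \<tau> \<eta> w\<^sub>0"
  have w: "?w j \<in> carrier_vec d" for j using dgd_carrier[OF w0] .
  have "grad F (?w (k - \<tau>)) = A *\<^sub>v ?w (k - \<tau>) + b"
    by (rule grad_quadratic[OF A sym b w F])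
  also have "\<dots> = A *\<^sub>v (?w (k - \<tau>) - wstar)"
  proof (rule eq_vecI)
    fix i assume "i < dim_vec (A *\<^sub>v (?w (k - \<tau>) - wstar))"
    then have i: "i < d" using A by simp
    have "(A *\<^sub>v wstar) $ i + b $ i = 0"
      using arg_cong[OF stat, of "\<lambda>x. x $ i"] i A b by simp
    then show "(A *\<^sub>v ?w (k - \<tau>) + b) $ i = (A *\<^sub>v (?w (k - \<tau>) - wstar)) $ i"
      using i A b w[of "k - \<tau>"] ws
      by (simp add: mult_minus_distrib_mat_vec[OF A w ws] del: index_mult_mat_vec)
  qed (use A b in simp)
  finally show ?thesis
    using k w[of k] ws A by (intro eq_vecI) auto
qed

text \<open>In eigencoordinates the error recursion decouples into scalar ones with
  \<open>x = \<eta> * l i\<close>. The scalar bound has the same constant for every eigenvalue, so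
  it can be summed over the coordinates.\<close>

lemma dgd_quadratic_form_bound:
  fixes k :: nat
  assumes A: "A \<in> carrier_mat d d" and sym: "transpose_mat A = A" and b: "b \<in> carrier_vec d"
    and ev: "\<And>l. eigenvalue A l \<Longrightarrow> 0 \<le> l \<and> l \<le> \<mu>"
    and F: "\<forall>w \<in> carrier_vec d. F w = quadratic A b c\<^sub>0 w"
    and w0: "w\<^sub>0 \<in> carrier_vec d" and ws: "wstar \<in> carrier_vec d"
    and stat: "A *\<^sub>v wstar + b = 0\<^sub>v d"
    and eta: "0 < \<eta>" "\<eta> * \<mu> * (real \<tau> + 1) \<le> 1 / 20"
  defines "h \<equiv> dgd F \<tau> \<eta> w\<^sub>0 k - wstar"
  shows "\<eta> * (h \<bullet> (A *\<^sub>v h)) \<le> 9 / (2 * exp 1 * (real k + 1)) * (euclid_norm (w\<^sub>0 - wstar))\<^sup>2"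
proof -
  obtain Q l where Q: "Q \<in> carrier_mat d d" and QQ: "transpose_mat Q * Q = 1\<^sub>m d"
    and l: "\<And>i. i < d \<Longrightarrow> eigenvalue A (l i)"
    and QA: "\<And>x i. x \<in> carrier_vec d \<Longrightarrow> i < d \<Longrightarrow> (Q *\<^sub>v (A *\<^sub>v x)) $ i = l i * (Q *\<^sub>v x) $ i"
    using symmetric_real_mat_eigencoordinates[OF A sym] by blast
  \<comment> \<open>Parseval: an orthogonal \<open>Q\<close> preserves scalar products.\<close>
  have iso: "x \<bullet> y = (\<Sum>i = 0..<d. (Q *\<^sub>v x) $ i * (Q *\<^sub>v y) $ i)"
    if x: "x \<in> carrier_vec d" and y: "y \<in> carrier_vec d" for x y
  proof -
    have "x \<bullet> y = ((transpose_mat Q * Q) *\<^sub>v x) \<bullet> y" using x by (simp add: QQ)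
    also have "\<dots> = (Q *\<^sub>v x) \<bullet> (Q *\<^sub>v y)"
      using Q x y by (simp add: transpose_vec_mult_scalar[OF Q y])
    finally show ?thesis using Q by (simp add: scalar_prod_def del: index_mult_mat_vec)
  qed
  define e where "e j = dgd F \<tau> \<eta> w\<^sub>0 j - wstar" for j
  have e: "e j \<in> carrier_vec d" for j using dgd_carrier[OF w0] ws by (simp add: e_def)
  define s where "s i j = (Q *\<^sub>v e j) $ i" for i j
  have bound: "\<eta> * l i * (s i k)\<^sup>2 \<le> 9 / (2 * exp 1 * (real k + 1)) * (s i 0)\<^sup>2" if i: "i < d" for i
  proof (rule delayed_recursion_square_bound[where s = "s i" and \<tau> = \<tau>])
    show "s i j = s i 0" if "j \<le> \<tau>" for j using that by (simp add: s_def e_def dgd_init)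
    show "s i (Suc j) = s i j - \<eta> * l i * s i (j - \<tau>)" if "\<tau> \<le> j" for j
    proof -
      have Ae: "A *\<^sub>v e (j - \<tau>) \<in> carrier_vec d" using A e by auto
      have "e (Suc j) = e j - \<eta> \<cdot>\<^sub>v (A *\<^sub>v e (j - \<tau>))"
        unfolding e_def by (rule dgd_quadratic_error_step[OF A sym b F w0 ws stat that])
      then have "Q *\<^sub>v e (Suc j) = Q *\<^sub>v e j - \<eta> \<cdot>\<^sub>v (Q *\<^sub>v (A *\<^sub>v e (j - \<tau>)))"
        using Ae e by (simp add: mult_minus_distrib_mat_vec[OF Q] mult_mat_vec[OF Q Ae])
      then show ?thesis
        using i Q QA[OF e i] unfolding s_def by (simp del: index_mult_mat_vec)
    qed
    have li: "0 \<le> l i" "l i \<le> \<mu>" using ev[OF l[OF i]] by auto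
    then show "0 \<le> \<eta> * l i" using eta by simp
    have "\<eta> * l i * (real \<tau> + 1) \<le> \<eta> * \<mu> * (real \<tau> + 1)"
      using eta li by (intro mult_right_mono mult_left_mono) auto
    then show "\<eta> * l i * (real \<tau> + 1) \<le> 1 / 20" using eta by linarith
  qed
  have h: "h = e k" "h \<in> carrier_vec d" using e by (auto simp: h_def e_def)
  \<comment> \<open>Parseval applied to \<open>h\<close> and \<open>A *\<^sub>v h\<close>, whose
    coordinates are \<open>s i k\<close> and \<open>l i * s i k\<close>.\<close>
  have "\<eta> * (h \<bullet> (A *\<^sub>v h)) = \<eta> * (\<Sum>i = 0..<d. s i k * (l i * s i k))"
    using h A QA[OF e] by (subst iso) (auto simp: s_def simp del: index_mult_mat_vec)
  also have "\<dots> = (\<Sum>i = 0..<d. \<eta> * l i * (s i k)\<^sup>2)"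
    unfolding sum_distrib_left by (rule sum.cong) (auto simp: power2_eq_square)
  also have "\<dots> \<le> (\<Sum>i = 0..<d. 9 / (2 * exp 1 * (real k + 1)) * (s i 0)\<^sup>2)"
    using bound by (intro sum_mono) auto
  also have "\<dots> = 9 / (2 * exp 1 * (real k + 1)) * (\<Sum>i = 0..<d. (s i 0)\<^sup>2)"
    by (simp only: sum_distrib_left)
  also have "(\<Sum>i = 0..<d. (s i 0)\<^sup>2) = e 0 \<bullet> e 0"
    using iso[OF e e, of 0 0] by (simp add: s_def power2_eq_square del: index_mult_mat_vec)
  also have "\<dots> = (euclid_norm (w\<^sub>0 - wstar))\<^sup>2"
    using real_scalar_prod_self(1)[of "e 0"] by (simp add: e_def euclid_norm_def)
  finally show ?thesis .
qed

section \<open>Convergence rates\<close>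

lemma dgd_quadratic_suboptimality:
  assumes mu: "\<mu> > 0" and F: "smooth_convex_quadratic d \<mu> F"
    and min: "is_arg_min F (\<lambda>w. w \<in> carrier_vec d) wstar"
    and eta: "0 < \<eta>" "\<eta> \<le> 1 / (20 * \<mu> * (real \<tau> + 1))"
    and w0: "w\<^sub>0 \<in> carrier_vec d"
  shows "F (dgd F \<tau> \<eta> w\<^sub>0 k) - F wstar
    \<le> 9 / (4 * exp 1 * \<eta> * (real k + 1)) * (euclid_norm (w\<^sub>0 - wstar))\<^sup>2"
proof -
  obtain A b c\<^sub>0 where A: "A \<in> carrier_mat d d" and sym: "transpose_mat A = A"
    and b: "b \<in> carrier_vec d" and ev: "\<And>l. eigenvalue A l \<Longrightarrow> 0 \<le> l \<and> l \<le> \<mu>"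
    and Fq: "\<forall>w \<in> carrier_vec d. F w = quadratic A b c\<^sub>0 w"
    using F unfolding smooth_convex_quadratic_def by blast
  have ws: "wstar \<in> carrier_vec d" and "\<And>x. x \<in> carrier_vec d \<Longrightarrow> F wstar \<le> F x"
    using min by (auto simp: is_arg_min_linorder)
  then have stat: "A *\<^sub>v wstar + b = 0\<^sub>v d"
    using Fq by (intro quadratic_minimizer_stationary[OF A sym b ws, of c\<^sub>0]) auto
  let ?w = "dgd F \<tau> \<eta> w\<^sub>0 k"
  define h where "h = ?w - wstar"
  have w: "?w \<in> carrier_vec d" by (rule dgd_carrier[OF w0])
  have h: "h \<in> carrier_vec d" "wstar + h = ?w" using w ws by (auto simp: h_def)
  have subopt: "F ?w - F wstar = 1 / 2 * (h \<bullet> (A *\<^sub>v h))"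
    using quadratic_add[OF A sym b ws h(1), of c\<^sub>0] Fq w ws h by (simp add: stat)
  have small: "\<eta> * \<mu> * (real \<tau> + 1) \<le> 1 / 20"
  proof -
    have "20 * \<mu> * (real \<tau> + 1) > 0" using mu by simp
    then show ?thesis using eta(2) by (simp add: pos_le_divide_eq mult_ac)
  qed
  have "\<eta> * (h \<bullet> (A *\<^sub>v h)) \<le> 9 / (2 * exp 1 * (real k + 1)) * (euclid_norm (w\<^sub>0 - wstar))\<^sup>2"
    unfolding h_def by (rule dgd_quadratic_form_bound[OF A sym b _ Fq w0 ws stat eta(1) small]) (rule ev)
  \<comment> \<open>Dividing by \<eta> undoes the weight, and the 1/2 of the quadratic expansion
    turns the 2 in the denominator into 4.\<close>
  then have "1 / (2 * \<eta>) * (\<eta> * (h \<bullet> (A *\<^sub>v h)))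
      \<le> 1 / (2 * \<eta>) * (9 / (2 * exp 1 * (real k + 1)) * (euclid_norm (w\<^sub>0 - wstar))\<^sup>2)"
    using eta(1) by (intro mult_left_mono) auto
  then show ?thesis using eta(1) by (simp add: subopt mult_ac)
qed

text \<open>The lower bound on the step size reads \<open>c \<le> \<eta> * \<mu> * \<tau>\<close>,
  which replaces \<open>1 / \<eta>\<close> by \<open>\<mu> * \<tau> / c\<close>; the shift from
  \<open>k + 1\<close> to \<open>k\<close> only weakens the bound.\<close>

lemma dgd_quadratic_suboptimality_large_step:
  assumes mu: "\<mu> > 0" and F: "smooth_convex_quadratic d \<mu> F"
    and min: "is_arg_min F (\<lambda>w. w \<in> carrier_vec d) wstar"
    and eta: "0 < \<eta>" "\<eta> \<le> 1 / (20 * \<mu> * (real \<tau> + 1))" "\<eta> \<ge> c / (\<mu> * real \<tau>)"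
    and w0: "w\<^sub>0 \<in> carrier_vec d"
    and c: "c > 0" and tau: "\<tau> \<ge> 1" and k: "k \<ge> 1"
  shows "F (dgd F \<tau> \<eta> w\<^sub>0 k) - F wstar
    \<le> 9 / (4 * exp 1 * c) * \<mu> * real \<tau> * (euclid_norm (w\<^sub>0 - wstar))\<^sup>2 / real k"
proof -
  let ?N = "(euclid_norm (w\<^sub>0 - wstar))\<^sup>2"
  have "c \<le> \<eta> * (\<mu> * real \<tau>)" using eta(3) mu tau by (simp add: pos_divide_le_eq)
  then have "c * real k \<le> \<eta> * (\<mu> * real \<tau>) * (real k + 1)" using c by (intro mult_mono) auto
  then have "1 / (\<eta> * (real k + 1)) \<le> \<mu> * real \<tau> / (c * real k)"
    using eta c k by (simp add: divide_simps mult_ac)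
  then have "9 / (4 * exp 1) * (1 / (\<eta> * (real k + 1))) * ?N \<le> 9 / (4 * exp 1) * (\<mu> * real \<tau> / (c * real k)) * ?N"
    by (intro mult_right_mono mult_left_mono) auto
  then show ?thesis
    using dgd_quadratic_suboptimality[OF mu F min eta(1,2) w0, of k] by (simp add: mult_ac)
qed

theorem theorem2:
  shows "(\<forall>(d::nat) (\<mu>::real) (\<tau>::nat) (F :: real vec \<Rightarrow> real) (wstar :: real vec)
            (\<eta>::real) (w\<^sub>0 :: real vec) (k::nat).
            \<mu> > 0 \<and> smooth_convex_quadratic d \<mu> F \<and> bdd_below (F ` carrier_vec d) \<and>
            is_arg_min F (\<lambda>w. w \<in> carrier_vec d) wstar \<and>
            0 < \<eta> \<and> \<eta> \<le> 1 / (20 * \<mu> * (real \<tau> + 1)) \<and>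
            w\<^sub>0 \<in> carrier_vec d \<and>
            real k \<ge> (real \<tau> + 1) * ln (2 * (real \<tau> + 1))
            \<longrightarrow> F (dgd F \<tau> \<eta> w\<^sub>0 k) - F wstar
                 \<le> 9 / (4 * exp 1 * \<eta> * (real k + 1)) * (euclid_norm (w\<^sub>0 - wstar))\<^sup>2)
       \<and> (\<forall>c::real. c > 0 \<longrightarrow> (\<exists>C::real. C > 0 \<and>
            (\<forall>(d::nat) (\<mu>::real) (\<tau>::nat) (F :: real vec \<Rightarrow> real) (wstar :: real vec)
               (\<eta>::real) (w\<^sub>0 :: real vec) (k::nat).
               \<mu> > 0 \<and> smooth_convex_quadratic d \<mu> F \<and> bdd_below (F ` carrier_vec d) \<and>
               is_arg_min F (\<lambda>w. w \<in> carrier_vec d) wstar \<and>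
               0 < \<eta> \<and> \<eta> \<le> 1 / (20 * \<mu> * (real \<tau> + 1)) \<and>
               w\<^sub>0 \<in> carrier_vec d \<and>
               real k \<ge> (real \<tau> + 1) * ln (2 * (real \<tau> + 1)) \<and>
               \<tau> \<ge> 1 \<and> \<eta> \<ge> c / (\<mu> * real \<tau>)
               \<longrightarrow> F (dgd F \<tau> \<eta> w\<^sub>0 k) - F wstar
                    \<le> C * \<mu> * real \<tau> * (euclid_norm (w\<^sub>0 - wstar))\<^sup>2 / real k)))"
proof (intro conjI allI impI, elim conjE)
  fix d \<tau> k :: nat and \<mu> \<eta> :: real and F and wstar w\<^sub>0 :: "real vec"
  assume "\<mu> > 0" "smooth_convex_quadratic d \<mu> F" "is_arg_min F (\<lambda>w. w \<in> carrier_vec d) wstar"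
    "0 < \<eta>" "\<eta> \<le> 1 / (20 * \<mu> * (real \<tau> + 1))" "w\<^sub>0 \<in> carrier_vec d"
  then show "F (dgd F \<tau> \<eta> w\<^sub>0 k) - F wstar
      \<le> 9 / (4 * exp 1 * \<eta> * (real k + 1)) * (euclid_norm (w\<^sub>0 - wstar))\<^sup>2"
    by (rule dgd_quadratic_suboptimality)
next
  fix c :: real
  assume c: "c > 0"
  \<comment> \<open>The threshold is positive because the logarithm has an argument of at least 2,
    so the division by \<open>k\<close> in the second claim is a genuine one.\<close>
  have k: "k \<ge> 1" if "real k \<ge> (real \<tau> + 1) * ln (2 * (real \<tau> + 1))" for k \<tau> :: nat
  proof -
    have "0 < (real \<tau> + 1) * ln (2 * (real \<tau> + 1))" by (intro mult_pos_pos ln_gt_zero) auto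
    then show ?thesis using that by linarith
  qed
  show "\<exists>C::real. C > 0 \<and>
            (\<forall>(d::nat) (\<mu>::real) (\<tau>::nat) (F :: real vec \<Rightarrow> real) (wstar :: real vec)
               (\<eta>::real) (w\<^sub>0 :: real vec) (k::nat).
               \<mu> > 0 \<and> smooth_convex_quadratic d \<mu> F \<and> bdd_below (F ` carrier_vec d) \<and>
               is_arg_min F (\<lambda>w. w \<in> carrier_vec d) wstar \<and>
               0 < \<eta> \<and> \<eta> \<le> 1 / (20 * \<mu> * (real \<tau> + 1)) \<and>
               w\<^sub>0 \<in> carrier_vec d \<and>
               real k \<ge> (real \<tau> + 1) * ln (2 * (real \<tau> + 1)) \<and>
               \<tau> \<ge> 1 \<and> \<eta> \<ge> c / (\<mu> * real \<tau>)
               \<longrightarrow> F (dgd F \<tau> \<eta> w\<^sub>0 k) - F wstar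
                    \<le> C * \<mu> * real \<tau> * (euclid_norm (w\<^sub>0 - wstar))\<^sup>2 / real k)"
  \<comment> \<open>The witness is the constant of the first claim with \<eta> replaced by
    \<open>c\<close>, so it depends on \<open>c\<close> alone.\<close>
  proof (intro exI[of _ "9 / (4 * exp 1 * c)"] conjI allI impI, goal_cases)
    case 1
    show "9 / (4 * exp 1 * c) > 0" using c by simp
  next
    case (2 d \<mu> \<tau> F wstar \<eta> w\<^sub>0 k)
    then show ?case
      using c k[of \<tau> k] by (elim conjE) (rule dgd_quadratic_suboptimality_large_step)
  qed
qed

end
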